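(* Let $M$ be a Lorentzian surface in a Lorentzian Kähler surface $(\tilde M^2_1,g,J)$. Then every tangent plane of $M$ is not $J$-invariant, i.e. $J(T_xM)\neq T_xM$ for every $x\in M$.
   Context: A Lorentzian Kähler surface is a Kähler manifold of complex dimension $2$ and complex index $1$ (so its real metric has signature $(2,2)$), with almost complex structure $J$. A Lorentzian surface in it is an immersed real surface whose induced metric has signature $(1,1)$. *)

theory Defs
  imports "HOL-Analysis.Analysis" "HOL-Library.Function_Algebras"
begin

text \<open>Pointwise real vector space structure on functions, used for tangent vectors below.\<close>

instantiation "fun" :: (type, real_vector) real_vector
begin

definition "scaleR r f = (\<lambda>x. r *\<^sub>R f x)"

instance
  by standard (auto simp: scaleR_fun_def fun_eq_iff algebra_simps)

end

section \<open>Smooth functions on open subsets of Euclidean spaces\<close>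

primrec k_times_differentiable_on ::
  "nat \<Rightarrow> ('e::euclidean_space \<Rightarrow> 'f::real_normed_vector) \<Rightarrow> 'e set \<Rightarrow> bool" where
  "k_times_differentiable_on 0 f S \<longleftrightarrow> continuous_on S f"
| "k_times_differentiable_on (Suc k) f S \<longleftrightarrow>
     (\<forall>x\<in>S. f differentiable (at x)) \<and>
     (\<forall>u. k_times_differentiable_on k (\<lambda>x. frechet_derivative f (at x) u) S)"

text \<open>This is the usual notion of being \<open>C\<^sup>\<infinity>\<close> for open \<open>S\<close>; it is only used for such sets.\<close>

definition smooth_on :: "('e::euclidean_space \<Rightarrow> 'f::real_normed_vector) \<Rightarrow> 'e set \<Rightarrow> bool" where
  "smooth_on f S \<longleftrightarrow> (\<forall>k. k_times_differentiable_on k f S)"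

section \<open>Smooth manifolds\<close>

text \<open>A chart is a pair of its domain and its coordinate map; the values of the map outside
  the domain are irrelevant. The dimension of the manifold is that of the model space \<open>'e\<close>.\<close>

type_synonym ('m, 'e) chart = "'m set \<times> ('m \<Rightarrow> 'e)"

definition chart_inv :: "('m, 'e) chart \<Rightarrow> 'e \<Rightarrow> 'm" where
  "chart_inv c = inv_into (fst c) (snd c)"

definition chart_image :: "('m, 'e) chart \<Rightarrow> 'e set" where
  "chart_image c = snd c ` fst c"

text \<open>Coordinate expression of \<open>F\<close> with respect to the charts \<open>c\<close> and \<open>d\<close>.\<close>

definition local_rep ::
  "('m, 'e) chart \<Rightarrow> ('n, 'f) chart \<Rightarrow> ('m \<Rightarrow> 'n) \<Rightarrow> 'e \<Rightarrow> 'f" where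
  "local_rep c d F = snd d \<circ> F \<circ> chart_inv c"

definition smooth_atlas :: "'m topology \<Rightarrow> ('m, 'e::euclidean_space) chart set \<Rightarrow> bool" where
  "smooth_atlas X A \<longleftrightarrow>
     (\<forall>c\<in>A. openin X (fst c) \<and> open (chart_image c) \<and>
        homeomorphic_map (subtopology X (fst c)) (top_of_set (chart_image c)) (snd c)) \<and>
     (\<Union>c\<in>A. fst c) = topspace X \<and>
     (\<forall>c\<in>A. \<forall>d\<in>A. smooth_on (local_rep c d id) (snd c ` (fst c \<inter> fst d)))"

definition smooth_manifold :: "'m topology \<Rightarrow> ('m, 'e::euclidean_space) chart set \<Rightarrow> bool" where
  "smooth_manifold X A \<longleftrightarrow> Hausdorff_space X \<and> second_countable X \<and> smooth_atlas X A"

text \<open>A tangent vector at \<open>p\<close> is the family of its coordinate vectors in all charts of the atlas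
  around \<open>p\<close>, any two of which are related by the derivative of the transition map.
  At charts not around \<open>p\<close> the family has the dummy value 0.\<close>

type_synonym ('m, 'e) tangent = "('m, 'e) chart \<Rightarrow> 'e"

definition tangent_space ::
  "('m, 'e::euclidean_space) chart set \<Rightarrow> 'm \<Rightarrow> ('m, 'e) tangent set" where
  "tangent_space A p =
     {v. (\<forall>c. \<not> (c \<in> A \<and> p \<in> fst c) \<longrightarrow> v c = 0) \<and>
         (\<forall>c\<in>A. \<forall>d\<in>A. p \<in> fst c \<longrightarrow> p \<in> fst d \<longrightarrow>
            v d = frechet_derivative (local_rep c d id) (at (snd c p)) (v c))}"

text \<open>The tangent vector at \<open>p\<close> whose coordinate vector in the chart \<open>c\<close> is \<open>a\<close>.\<close>

definition chart_vector ::
  "('m, 'e::euclidean_space) chart set \<Rightarrow> ('m, 'e) chart \<Rightarrow> 'm \<Rightarrow> 'e \<Rightarrow> ('m, 'e) tangent" where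
  "chart_vector A c p a =
     (\<lambda>d. if d \<in> A \<and> p \<in> fst d
          then frechet_derivative (local_rep c d id) (at (snd c p)) a else 0)"

definition smooth_map ::
  "'m topology \<Rightarrow> ('m, 'e::euclidean_space) chart set \<Rightarrow>
   'n topology \<Rightarrow> ('n, 'f::euclidean_space) chart set \<Rightarrow> ('m \<Rightarrow> 'n) \<Rightarrow> bool" where
  "smooth_map X A Y B F \<longleftrightarrow> continuous_map X Y F \<and>
     (\<forall>c\<in>A. \<forall>d\<in>B. smooth_on (local_rep c d F) (snd c ` {x \<in> fst c. F x \<in> fst d}))"

text \<open>By the chain rule the result does not depend on the choice of the chart around \<open>x\<close>.\<close>

definition differential ::
  "('m, 'e::euclidean_space) chart set \<Rightarrow> ('n, 'f::euclidean_space) chart set \<Rightarrow>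
   ('m \<Rightarrow> 'n) \<Rightarrow> 'm \<Rightarrow> ('m, 'e) tangent \<Rightarrow> ('n, 'f) tangent" where
  "differential A B F x v =
     (\<lambda>d. if d \<in> B \<and> F x \<in> fst d
          then let c = (SOME c. c \<in> A \<and> x \<in> fst c)
               in frechet_derivative (local_rep c d F) (at (snd c x)) (v c)
          else 0)"

definition immersion ::
  "'m topology \<Rightarrow> ('m, 'e::euclidean_space) chart set \<Rightarrow>
   'n topology \<Rightarrow> ('n, 'f::euclidean_space) chart set \<Rightarrow> ('m \<Rightarrow> 'n) \<Rightarrow> bool" where
  "immersion X A Y B F \<longleftrightarrow> smooth_map X A Y B F \<and>
     (\<forall>x\<in>topspace X. inj_on (differential A B F x) (tangent_space A x))"

section \<open>Scalar products\<close>

definition linear_map_on :: "'v::real_vector set \<Rightarrow> ('v \<Rightarrow> 'w::real_vector) \<Rightarrow> bool" where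
  "linear_map_on V f \<longleftrightarrow>
     (\<forall>u\<in>V. \<forall>v\<in>V. f (u + v) = f u + f v) \<and> (\<forall>r. \<forall>v\<in>V. f (r *\<^sub>R v) = r *\<^sub>R f v)"

definition scalar_product_on :: "'v::real_vector set \<Rightarrow> ('v \<Rightarrow> 'v \<Rightarrow> real) \<Rightarrow> bool" where
  "scalar_product_on V b \<longleftrightarrow>
     (\<forall>u\<in>V. linear_map_on V (b u)) \<and> (\<forall>u\<in>V. \<forall>v\<in>V. b u v = b v u) \<and>
     (\<forall>u\<in>V. (\<forall>v\<in>V. b u v = 0) \<longrightarrow> u = 0)"

definition negative_definite_on :: "'v::real_vector set \<Rightarrow> ('v \<Rightarrow> 'v \<Rightarrow> real) \<Rightarrow> bool" where
  "negative_definite_on W b \<longleftrightarrow> (\<forall>w\<in>W. w \<noteq> 0 \<longrightarrow> b w w < 0)"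

definition index_on :: "'v::real_vector set \<Rightarrow> ('v \<Rightarrow> 'v \<Rightarrow> real) \<Rightarrow> nat" where
  "index_on V b =
     (GREATEST k. \<exists>W. subspace W \<and> W \<subseteq> V \<and> negative_definite_on W b \<and> dim W = k)"

text \<open>The numbers of positive and of negative directions, in this order.\<close>

definition signature_on :: "'v::real_vector set \<Rightarrow> ('v \<Rightarrow> 'v \<Rightarrow> real) \<Rightarrow> nat \<times> nat" where
  "signature_on V b = (index_on V (\<lambda>u v. - b u v), index_on V b)"

text \<open>The largest complex dimension of a negative definite complex subspace, where complex
  subspaces are the \<open>j\<close>-invariant real ones and their real dimension is twice the complex one.\<close>

definition complex_index_on ::
  "'v::real_vector set \<Rightarrow> ('v \<Rightarrow> 'v) \<Rightarrow> ('v \<Rightarrow> 'v \<Rightarrow> real) \<Rightarrow> nat" where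
  "complex_index_on V j b =
     (GREATEST k. \<exists>W. subspace W \<and> W \<subseteq> V \<and> j ` W \<subseteq> W \<and> negative_definite_on W b \<and> dim W = 2 * k)"

section \<open>Pseudo-Riemannian metrics and almost complex structures\<close>

type_synonym ('m, 'e) metric = "'m \<Rightarrow> ('m, 'e) tangent \<Rightarrow> ('m, 'e) tangent \<Rightarrow> real"

type_synonym ('m, 'e) endo = "'m \<Rightarrow> ('m, 'e) tangent \<Rightarrow> ('m, 'e) tangent"

definition metric_rep ::
  "('m, 'e::euclidean_space) chart set \<Rightarrow> ('m, 'e) metric \<Rightarrow> ('m, 'e) chart \<Rightarrow>
   'e \<Rightarrow> 'e \<Rightarrow> 'e \<Rightarrow> real" where
  "metric_rep A g c y a b =
     (let p = chart_inv c y in g p (chart_vector A c p a) (chart_vector A c p b))"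

definition endo_rep ::
  "('m, 'e::euclidean_space) chart set \<Rightarrow> ('m, 'e) endo \<Rightarrow> ('m, 'e) chart \<Rightarrow> 'e \<Rightarrow> 'e \<Rightarrow> 'e" where
  "endo_rep A J c y a = (let p = chart_inv c y in J p (chart_vector A c p a) c)"

definition pseudo_riemannian_metric ::
  "'m topology \<Rightarrow> ('m, 'e::euclidean_space) chart set \<Rightarrow> ('m, 'e) metric \<Rightarrow> bool" where
  "pseudo_riemannian_metric X A g \<longleftrightarrow>
     (\<forall>p\<in>topspace X. scalar_product_on (tangent_space A p) (g p)) \<and>
     (\<forall>c\<in>A. \<forall>a b. smooth_on (\<lambda>y. metric_rep A g c y a b) (chart_image c))"

definition almost_complex_structure ::
  "'m topology \<Rightarrow> ('m, 'e::euclidean_space) chart set \<Rightarrow> ('m, 'e) endo \<Rightarrow> bool" where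
  "almost_complex_structure X A J \<longleftrightarrow>
     (\<forall>p\<in>topspace X. linear_map_on (tangent_space A p) (J p) \<and>
        J p ` tangent_space A p \<subseteq> tangent_space A p \<and>
        (\<forall>v\<in>tangent_space A p. J p (J p v) = - v)) \<and>
     (\<forall>c\<in>A. \<forall>a. smooth_on (\<lambda>y. endo_rep A J c y a) (chart_image c))"

text \<open>The Levi-Civita covariant derivative of coordinate vector fields with constant coefficients
  \<open>a\<close> and \<open>b\<close>, given by the Koszul formula (such fields commute).\<close>

definition christoffel ::
  "('m, 'e::euclidean_space) chart set \<Rightarrow> ('m, 'e) metric \<Rightarrow> ('m, 'e) chart \<Rightarrow>
   'e \<Rightarrow> 'e \<Rightarrow> 'e \<Rightarrow> 'e" where
  "christoffel A g c y a b = (THE z. \<forall>w.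
     2 * metric_rep A g c y z w =
       frechet_derivative (\<lambda>y. metric_rep A g c y b w) (at y) a
     + frechet_derivative (\<lambda>y. metric_rep A g c y a w) (at y) b
     - frechet_derivative (\<lambda>y. metric_rep A g c y a b) (at y) w)"

text \<open>The Levi-Civita covariant derivative, in the chart \<open>c\<close>, of a vector field \<open>Y\<close> in the
  direction \<open>a\<close> at the point with coordinates \<open>y\<close>.\<close>

definition levi_civita ::
  "('m, 'e::euclidean_space) chart set \<Rightarrow> ('m, 'e) metric \<Rightarrow> ('m, 'e) chart \<Rightarrow>
   'e \<Rightarrow> 'e \<Rightarrow> ('e \<Rightarrow> 'e) \<Rightarrow> 'e" where
  "levi_civita A g c y a Y = frechet_derivative Y (at y) a + christoffel A g c y a (Y y)"

text \<open>\<open>\<nabla>J = 0\<close>, that is \<open>\<nabla>\<^sub>a (J Y) = J (\<nabla>\<^sub>a Y)\<close> for all local vector fields \<open>Y\<close>.\<close>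

definition parallel_endo ::
  "('m, 'e::euclidean_space) chart set \<Rightarrow> ('m, 'e) metric \<Rightarrow> ('m, 'e) endo \<Rightarrow> bool" where
  "parallel_endo A g J \<longleftrightarrow>
     (\<forall>c\<in>A. \<forall>y\<in>chart_image c. \<forall>a Y. smooth_on Y (chart_image c) \<longrightarrow>
        levi_civita A g c y a (\<lambda>y. endo_rep A J c y (Y y)) =
        endo_rep A J c y (levi_civita A g c y a Y))"

definition pseudo_kaehler_manifold ::
  "'m topology \<Rightarrow> ('m, 'e::euclidean_space) chart set \<Rightarrow>
   ('m, 'e) metric \<Rightarrow> ('m, 'e) endo \<Rightarrow> bool" where
  "pseudo_kaehler_manifold X A g J \<longleftrightarrow>
     smooth_manifold X A \<and> pseudo_riemannian_metric X A g \<and> almost_complex_structure X A J \<and>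
     (\<forall>p\<in>topspace X. \<forall>u\<in>tangent_space A p. \<forall>v\<in>tangent_space A p.
        g p (J p u) (J p v) = g p u v) \<and>
     parallel_endo A g J"

definition lorentzian_kaehler_surface ::
  "'m topology \<Rightarrow> ('m, real^4) chart set \<Rightarrow>
   ('m, real^4) metric \<Rightarrow> ('m, real^4) endo \<Rightarrow> bool" where
  "lorentzian_kaehler_surface X A g J \<longleftrightarrow>
     pseudo_kaehler_manifold X A g J \<and>
     (\<forall>p\<in>topspace X. complex_index_on (tangent_space A p) (J p) (g p) = 1)"

section \<open>Lorentzian surfaces\<close>

definition induced_metric ::
  "('n, 'f::euclidean_space) chart set \<Rightarrow> ('m, 'e::euclidean_space) chart set \<Rightarrow>
   ('m, 'e) metric \<Rightarrow> ('n \<Rightarrow> 'm) \<Rightarrow> ('n, 'f) metric" where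
  "induced_metric B A g F x u v = g (F x) (differential B A F x u) (differential B A F x v)"

definition lorentzian_surface_in ::
  "'n topology \<Rightarrow> ('n, real^2) chart set \<Rightarrow> ('n \<Rightarrow> 'm) \<Rightarrow>
   'm topology \<Rightarrow> ('m, real^4) chart set \<Rightarrow> ('m, real^4) metric \<Rightarrow> bool" where
  "lorentzian_surface_in M B F X A g \<longleftrightarrow>
     smooth_manifold M B \<and> immersion M B X A F \<and>
     (\<forall>x\<in>topspace M. signature_on (tangent_space B x) (induced_metric B A g F x) = (1, 1))"

text \<open>The tangent plane at \<open>x\<close> of an immersed manifold, as a subspace of the tangent space of the
  ambient manifold at \<open>F x\<close>.\<close>

definition tangent_plane ::
  "('n, 'f::euclidean_space) chart set \<Rightarrow> ('m, 'e::euclidean_space) chart set \<Rightarrow>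
   ('n \<Rightarrow> 'm) \<Rightarrow> 'n \<Rightarrow> ('m, 'e) tangent set" where
  "tangent_plane B A F x = differential B A F x ` tangent_space B x"

end

theory Submission
  imports Defs
begin

text \<open>
  Along a \<open>J\<close>-invariant tangent plane the induced metric would be definite. Indeed, the Hermitian
  condition together with \<open>J\<^sup>2 = -1\<close> makes \<open>J\<close> skew-adjoint, so \<open>V\<close> and \<open>J V\<close> are orthogonal,
  and they have the same square norm. Hence the metric on the plane spanned by \<open>V\<close> and \<open>J V\<close> is
  the multiple \<open>g(V, V)\<close> of a Euclidean one (lemma \<open>complex_line_norm\<close>). In a Lorentzian plane
  we may choose \<open>V\<close> with \<open>g(V, V) < 0\<close> and \<open>U\<close> with \<open>g(U, U) > 0\<close> (lemma \<open>index_on_nonzeroE\<close>). If the plane is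
  \<open>J\<close>-invariant, it contains the three vectors \<open>U\<close>, \<open>V\<close>, \<open>J V\<close>, which must be dependent; but the
  square norm of a multiple of \<open>U\<close> is nonnegative and that of a combination of \<open>V\<close> and \<open>J V\<close>
  is nonpositive, so every coefficient of a dependence vanishes.

  The rest is the passage from charts to linear algebra. Evaluation in a chart embeds a tangent
  space linearly into the model space (lemma \<open>tangent_eval_inj\<close>), which bounds dimensions: this
  guarantees that the maximum in the definition of the index is attained, and it gives the
  dependence above. The chain rule shows that the differential takes its values in the ambient
  tangent space (lemma \<open>differential_in_tangent_space\<close>), where \<open>g\<close> and \<open>J\<close> are controlled.
\<close>

section \<open>Indices and complex lines\<close>

text \<open>The dimension bound makes the maximum in the definition of the index exist, so that a
  nonzero index is witnessed by an actual subspace.\<close>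

lemma index_on_nonzeroE:
  assumes V: "subspace V"
    and bound: "\<And>W. subspace W \<Longrightarrow> W \<subseteq> V \<Longrightarrow> dim W \<le> n"
    and nz: "index_on V b \<noteq> 0"
  obtains v where "v \<in> V" "b v v < 0"
proof -
  define P where
    "P = (\<lambda>k. \<exists>W. subspace W \<and> W \<subseteq> V \<and> negative_definite_on W b \<and> dim W = k)"
  have dim0: "dim {0::'a} = 0"
    using dim_eq_card[of "{}" "{0::'a}"] by (simp add: independent_empty)
  have "P 0"
    unfolding P_def negative_definite_on_def
    using V dim0 by (intro exI[of _ "{0}"]) (auto simp: subspace_0)
  then have "P (index_on V b)"
    unfolding index_on_def P_def[symmetric]
    using GreatestI_nat[of P 0 n] bound by (auto simp: P_def)
  then obtain W where W: "subspace W" "W \<subseteq> V" "negative_definite_on W b" "dim W \<noteq> 0"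
    using nz by (auto simp: P_def)
  have "W \<noteq> {0}"
    using W(4) dim0 by auto
  then obtain w where "w \<in> W" "w \<noteq> 0"
    using subspace_0[OF W(1)] by blast
  then show thesis
    using that W(2,3) by (auto simp: negative_definite_on_def)
qed

lemma scalar_product_on_add:
  assumes "subspace V" "scalar_product_on V b" "x \<in> V" "y \<in> V" "z \<in> V"
  shows "b x (y + z) = b x y + b x z" "b (y + z) x = b y x + b z x"
  using assms subspace_add[OF assms(1)]
  by (auto simp: scalar_product_on_def linear_map_on_def)

lemma scalar_product_on_scaleR:
  assumes "subspace V" "scalar_product_on V b" "x \<in> V" "y \<in> V"
  shows "b x (r *\<^sub>R y) = r * b x y" "b (r *\<^sub>R y) x = r * b y x"
  using assms subspace_scale[OF assms(1)]
  by (auto simp: scalar_product_on_def linear_map_on_def)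

text \<open>The isometry property gives \<open>b(v, j v) = b(j v, j (j v)) = - b(j v, v)\<close>, so the cross
  terms vanish.\<close>

lemma complex_line_norm:
  assumes V: "subspace V" and b: "scalar_product_on V b"
    and j: "j v \<in> V" "j (j v) = - v"
    and iso: "\<And>x y. x \<in> V \<Longrightarrow> y \<in> V \<Longrightarrow> b (j x) (j y) = b x y"
    and v: "v \<in> V"
  shows "b (s *\<^sub>R v + t *\<^sub>R j v) (s *\<^sub>R v + t *\<^sub>R j v) = (s\<^sup>2 + t\<^sup>2) * b v v"
proof -
  have sym: "b v (j v) = b (j v) v"
    using b v j(1) by (auto simp: scalar_product_on_def)
  have "b v (j v) = b (j v) (- v)"
    using iso[OF v j(1)] j(2) by simp
  also have "\<dots> = - b (j v) v"
    using scalar_product_on_scaleR(1)[OF V b j(1) v, of "-1"] by simp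
  finally have orth: "b v (j v) = 0" "b (j v) v = 0"
    using sym by auto
  show ?thesis
    using v j(1) orth iso[OF v v] subspace_add[OF V] subspace_scale[OF V]
    by (simp add: scalar_product_on_add[OF V b] scalar_product_on_scaleR[OF V b]
        power2_eq_square algebra_simps)
qed

section \<open>Vectors in the coordinate plane\<close>

text \<open>A dependence is a kernel vector of the map from the coordinate 3-space to the plane that
  has the given vectors as columns; stated with coefficients, it also covers coinciding vectors.\<close>

lemma three_vectors_in_plane_dependent:
  fixes u v w :: "real^2"
  obtains r s t where "(r, s, t) \<noteq> (0, 0, 0)" "r *\<^sub>R u + s *\<^sub>R v + t *\<^sub>R w = 0"
proof -
  define h :: "real^3 \<Rightarrow> real^2" where
    "h x = (x$1) *\<^sub>R u + (x$2) *\<^sub>R v + (x$3) *\<^sub>R w" for x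
  have lin: "linear h"
    unfolding h_def by (rule linearI) (auto simp: algebra_simps)
  have "\<not> inj h"
  proof
    assume "inj h"
    then have "dim (range h) = dim (UNIV :: (real^3) set)"
      using dim_image_eq[OF lin, of UNIV] by simp
    then show False
      using dim_subset_UNIV[of "range h"] by simp
  qed
  then obtain x where "h x = 0" "x \<noteq> 0"
    using linear_injective_0[OF lin] by auto
  then show thesis
    using that[of "x$1" "x$2" "x$3"] by (auto simp: h_def vec_eq_iff forall_3)
qed

lemma dim_le_DIM_of_injective_linear:
  fixes f :: "'v::real_vector \<Rightarrow> 'e::euclidean_space"
  assumes f: "linear f" "inj_on f W" and W: "subspace W"
  shows "dim W \<le> DIM('e)"
proof -
  obtain B where B: "B \<subseteq> W" "independent B" "W \<subseteq> span B" "card B = dim W"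
    using basis_exists by blast
  have sp: "span B \<subseteq> W"
    using span_minimal[OF B(1) W] .
  have "independent (f ` B)"
    using linear_independent_injective_image[OF f(1) B(2)] inj_on_subset[OF f(2) sp] by simp
  then have "card (f ` B) \<le> DIM('e)"
    using independent_bound by blast
  then show ?thesis
    using card_image[OF inj_on_subset[OF f(2) B(1)]] B(4) by simp
qed

section \<open>Tangent spaces and differentials in charts\<close>

lemma smooth_on_differentiable:
  assumes "smooth_on f S" "x \<in> S"
  shows "f differentiable (at x)"
  using assms k_times_differentiable_on.simps(2)[of 0 f S] by (auto simp: smooth_on_def)

lemma smooth_map_differentiable:
  assumes "smooth_map X A Y B F" "c \<in> A" "d \<in> B" "x \<in> fst c" "F x \<in> fst d"
  shows "local_rep c d F differentiable (at (snd c x))"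
  using assms smooth_on_differentiable[of "local_rep c d F"]
  by (auto simp: smooth_map_def)

lemma transition_differentiable:
  assumes "smooth_atlas X A" "c \<in> A" "d \<in> A" "x \<in> fst c" "x \<in> fst d"
  shows "local_rep c d id differentiable (at (snd c x))"
proof (rule smooth_on_differentiable)
  show "smooth_on (local_rep c d id) (snd c ` (fst c \<inter> fst d))"
    using assms(1-3) by (simp add: smooth_atlas_def)
  show "snd c x \<in> snd c ` (fst c \<inter> fst d)"
    using assms(4,5) by blast
qed

lemma smooth_atlas_covers:
  assumes "smooth_atlas X A" "x \<in> topspace X"
  obtains c where "c \<in> A" "x \<in> fst c"
proof -
  have "x \<in> (\<Union>c\<in>A. fst c)"
    using assms by (simp add: smooth_atlas_def)
  then show thesis
    using that by blast
qed

lemma chart_inv_chart: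
  assumes "smooth_atlas X A" "c \<in> A" "x \<in> fst c"
  shows "chart_inv c (snd c x) = x"
proof -
  have "openin X (fst c)"
    and h: "homeomorphic_map (subtopology X (fst c)) (top_of_set (chart_image c)) (snd c)"
    using assms(1,2) by (auto simp: smooth_atlas_def)
  then have "topspace (subtopology X (fst c)) = fst c"
    using openin_subset by fastforce
  then have "inj_on (snd c) (fst c)"
    using homeomorphic_imp_injective_map[OF h] by simp
  then show ?thesis
    using assms(3) by (simp add: chart_inv_def)
qed

lemma open_chart_of_open:
  assumes A: "smooth_atlas X A" "c \<in> A" and U: "openin X U" "U \<subseteq> fst c"
  shows "open (snd c ` U)"
proof -
  have "open (chart_image c)"
    and h: "homeomorphic_map (subtopology X (fst c)) (top_of_set (chart_image c)) (snd c)"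
    using A by (auto simp: smooth_atlas_def)
  moreover have "openin (subtopology X (fst c)) U"
    using U by (auto simp: openin_subtopology)
  ultimately show ?thesis
    using homeomorphic_imp_open_map[OF h] openin_open_eq[of "chart_image c" "snd c ` U"]
    by (auto simp: open_map_def)
qed

lemma tangent_spaceI:
  assumes "\<And>c. \<not> (c \<in> A \<and> p \<in> fst c) \<Longrightarrow> v c = 0"
    and "\<And>c d. c \<in> A \<Longrightarrow> d \<in> A \<Longrightarrow> p \<in> fst c \<Longrightarrow> p \<in> fst d \<Longrightarrow>
      v d = frechet_derivative (local_rep c d id) (at (snd c p)) (v c)"
  shows "v \<in> tangent_space A p"
  unfolding tangent_space_def using assms by blast

lemma tangent_space_zero:
  "v \<in> tangent_space A p \<Longrightarrow> \<not> (c \<in> A \<and> p \<in> fst c) \<Longrightarrow> v c = 0"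
  unfolding tangent_space_def by blast

lemma tangent_space_transition:
  assumes "v \<in> tangent_space A p" "c \<in> A" "d \<in> A" "p \<in> fst c" "p \<in> fst d"
  shows "v d = frechet_derivative (local_rep c d id) (at (snd c p)) (v c)"
  using assms unfolding tangent_space_def by blast

lemma subspace_tangent_space:
  assumes A: "smooth_atlas X A"
  shows "subspace (tangent_space A p)"
proof -
  have lin: "linear (frechet_derivative (local_rep c d id) (at (snd c p)))"
    if "c \<in> A" "d \<in> A" "p \<in> fst c" "p \<in> fst d" for c d
    using linear_frechet_derivative[OF transition_differentiable[OF A that]] .
  show ?thesis
  proof (rule subspaceI)
    show "0 \<in> tangent_space A p"
      by (rule tangent_spaceI) (simp_all add: linear_0[OF lin])
  next
    fix u v
    assume u: "u \<in> tangent_space A p" and v: "v \<in> tangent_space A p"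
    show "u + v \<in> tangent_space A p"
    proof (rule tangent_spaceI)
      fix c d
      assume cd: "c \<in> A" "d \<in> A" "p \<in> fst c" "p \<in> fst d"
      show "(u + v) d = frechet_derivative (local_rep c d id) (at (snd c p)) ((u + v) c)"
        unfolding plus_fun_apply linear_add[OF lin[OF cd]]
        using tangent_space_transition[OF u cd] tangent_space_transition[OF v cd] by (rule arg_cong2)
    qed (simp add: tangent_space_zero[OF u] tangent_space_zero[OF v])
  next
    fix r v
    assume v: "v \<in> tangent_space A p"
    show "r *\<^sub>R v \<in> tangent_space A p"
    proof (rule tangent_spaceI)
      fix c d
      assume cd: "c \<in> A" "d \<in> A" "p \<in> fst c" "p \<in> fst d"
      show "(r *\<^sub>R v) d = frechet_derivative (local_rep c d id) (at (snd c p)) ((r *\<^sub>R v) c)"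
        unfolding scaleR_fun_def linear_scale[OF lin[OF cd]]
        using tangent_space_transition[OF v cd] by (rule arg_cong)
    qed (simp add: scaleR_fun_def tangent_space_zero[OF v])
  qed
qed

lemma linear_tangent_eval: "linear (\<lambda>v :: ('m, 'e::euclidean_space) tangent. v c)"
  by (rule linearI) (auto simp: scaleR_fun_def)

text \<open>The transition rule determines all coordinate vectors from the one in a single chart.\<close>

lemma tangent_eval_inj:
  assumes A: "smooth_atlas X A" and c: "c \<in> A" "p \<in> fst c"
  shows "inj_on (\<lambda>v. v c) (tangent_space A p)"
proof (rule inj_onI, rule ext)
  fix u v d
  assume u: "u \<in> tangent_space A p" and v: "v \<in> tangent_space A p" and eq: "u c = v c"
  show "u d = v d"
  proof (cases "d \<in> A \<and> p \<in> fst d")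
    case True
    then show ?thesis
      using tangent_space_transition[OF u c(1) _ c(2), of d]
        tangent_space_transition[OF v c(1) _ c(2), of d] eq by simp
  next
    case False
    then show ?thesis
      using tangent_space_zero[OF u] tangent_space_zero[OF v] by simp
  qed
qed

text \<open>The source chart is an arbitrary choice, but the same one for all tangent vectors and all
  target charts; linearity and the chain rule rest on this uniformity.\<close>

lemma differential_chartE:
  assumes B: "smooth_atlas M B" and x: "x \<in> topspace M"
  obtains c where "c \<in> B" "x \<in> fst c"
    "\<forall>v. \<forall>d\<in>A. F x \<in> fst d \<longrightarrow>
      differential B A F x v d = frechet_derivative (local_rep c d F) (at (snd c x)) (v c)"
proof -
  define c where "c = (SOME c. c \<in> B \<and> x \<in> fst c)"
  have "\<exists>c. c \<in> B \<and> x \<in> fst c"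
    using smooth_atlas_covers[OF B x] by blast
  then have "c \<in> B \<and> x \<in> fst c"
    unfolding c_def by (rule someI_ex)
  then show thesis
    using that[of c] by (simp add: differential_def Let_def c_def[symmetric])
qed

lemma linear_differential:
  assumes B: "smooth_atlas M B" and F: "smooth_map M B X A F" and x: "x \<in> topspace M"
  shows "linear (differential B A F x)"
proof -
  obtain c where c: "c \<in> B" "x \<in> fst c"
    and coord: "\<forall>v. \<forall>d\<in>A. F x \<in> fst d \<longrightarrow>
      differential B A F x v d = frechet_derivative (local_rep c d F) (at (snd c x)) (v c)"
    using differential_chartE[OF B x, of A F] .
  have lin: "linear (frechet_derivative (local_rep c d F) (at (snd c x)))"
    if "d \<in> A" "F x \<in> fst d" for d
    using linear_frechet_derivative[OF smooth_map_differentiable[OF F c(1) that(1) c(2) that(2)]] .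
  have zero: "differential B A F x v d = 0" if "\<not> (d \<in> A \<and> F x \<in> fst d)" for v d
    using that by (auto simp: differential_def)
  show ?thesis
  proof (rule linearI; rule ext)
    fix u v d
    show "differential B A F x (u + v) d = (differential B A F x u + differential B A F x v) d"
      by (cases "d \<in> A \<and> F x \<in> fst d") (simp_all add: coord zero linear_add[OF lin])
  next
    fix r v d
    show "differential B A F x (r *\<^sub>R v) d = (r *\<^sub>R differential B A F x v) d"
      by (cases "d \<in> A \<and> F x \<in> fst d")
        (simp_all add: coord zero scaleR_fun_def linear_scale[OF lin])
  qed
qed

text \<open>The coordinate representations of a map in two target charts differ by the transition map
  on a whole neighbourhood, so the chain rule gives the compatibility between charts that defines
  a tangent vector.\<close>

lemma differential_in_tangent_space:
  assumes B: "smooth_atlas M B" and A: "smooth_atlas X A"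
    and F: "smooth_map M B X A F" and x: "x \<in> topspace M"
  shows "differential B A F x v \<in> tangent_space A (F x)"
proof -
  obtain c where c: "c \<in> B" "x \<in> fst c"
    and coord: "\<forall>v. \<forall>d\<in>A. F x \<in> fst d \<longrightarrow>
      differential B A F x v d = frechet_derivative (local_rep c d F) (at (snd c x)) (v c)"
    using differential_chartE[OF B x, of A F] .
  have chain: "frechet_derivative (local_rep c e F) (at (snd c x)) =
      frechet_derivative (local_rep d e id) (at (snd d (F x))) \<circ>
      frechet_derivative (local_rep c d F) (at (snd c x))"
    if d: "d \<in> A" "F x \<in> fst d" and e: "e \<in> A" "F x \<in> fst e" for d e
  proof -
    define U where "U = {z \<in> topspace M. F z \<in> fst d \<inter> fst e} \<inter> fst c"
    have "openin X (fst d \<inter> fst e)" "openin M (fst c)"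
      using A B c d e by (auto simp: smooth_atlas_def)
    moreover have "continuous_map M X F"
      using F by (simp add: smooth_map_def)
    ultimately have "openin M U"
      unfolding U_def by (intro openin_Int[of M] openin_continuous_map_preimage)
    then have op: "open (snd c ` U)"
      using open_chart_of_open[OF B c(1)] by (auto simp: U_def)
    have xU: "snd c x \<in> snd c ` U"
      using x c d e by (auto simp: U_def)
    have rep: "local_rep c d F (snd c x) = snd d (F x)"
      using chart_inv_chart[OF B c] by (simp add: local_rep_def)
    have "(local_rep c d F has_derivative
        frechet_derivative (local_rep c d F) (at (snd c x))) (at (snd c x))"
      using smooth_map_differentiable[OF F c(1) d(1) c(2) d(2)] frechet_derivative_works by blast
    moreover have "(local_rep d e id has_derivative
        frechet_derivative (local_rep d e id) (at (snd d (F x)))) (at (snd d (F x)))"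
      using transition_differentiable[OF A d(1) e(1) d(2) e(2)] frechet_derivative_works by blast
    ultimately have "(local_rep d e id \<circ> local_rep c d F has_derivative
        frechet_derivative (local_rep d e id) (at (snd d (F x))) \<circ>
        frechet_derivative (local_rep c d F) (at (snd c x))) (at (snd c x))"
      using rep by (intro diff_chain_at) auto
    moreover have "(local_rep d e id \<circ> local_rep c d F) y = local_rep c e F y"
      if "y \<in> snd c ` U" for y
      using that chart_inv_chart[OF B c(1)] chart_inv_chart[OF A d(1)]
      by (auto simp: local_rep_def U_def)
    ultimately have "(local_rep c e F has_derivative
        frechet_derivative (local_rep d e id) (at (snd d (F x))) \<circ>
        frechet_derivative (local_rep c d F) (at (snd c x))) (at (snd c x))"
      using has_derivative_transform_within_open[OF _ op xU] by blast
    then show ?thesis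
      using frechet_derivative_at by metis
  qed
  show ?thesis
  proof (rule tangent_spaceI)
    fix d e
    assume de: "d \<in> A" "e \<in> A" "F x \<in> fst d" "F x \<in> fst e"
    show "differential B A F x v e =
        frechet_derivative (local_rep d e id) (at (snd d (F x))) (differential B A F x v d)"
      using chain[OF de(1,3,2,4)] by (simp add: coord de)
  qed (auto simp: differential_def)
qed

section \<open>Lorentzian surfaces have no complex tangent planes\<close>

theorem proposition3p1:
  fixes X :: "'m topology" and A :: "('m, real^4) chart set"
    and g :: "('m, real^4) metric" and J :: "('m, real^4) endo"
    and M :: "'n topology" and B :: "('n, real^2) chart set" and F :: "'n \<Rightarrow> 'm"
  assumes "lorentzian_kaehler_surface X A g J"
    and "lorentzian_surface_in M B F X A g"
  shows "\<forall>x\<in>topspace M. J (F x) ` tangent_plane B A F x \<noteq> tangent_plane B A F x"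
proof (intro ballI notI)
  fix x
  assume x: "x \<in> topspace M"
    and inv: "J (F x) ` tangent_plane B A F x = tangent_plane B A F x"
  let ?T = "tangent_space B x" and ?E = "tangent_space A (F x)"
  let ?D = "differential B A F x" and ?b = "g (F x)" and ?j = "J (F x)"
  let ?h = "induced_metric B A g F x"
  have K: "pseudo_kaehler_manifold X A g J"
    using assms(1) by (simp add: lorentzian_kaehler_surface_def)
  have A: "smooth_atlas X A"
    using K by (simp add: pseudo_kaehler_manifold_def smooth_manifold_def)
  have B: "smooth_atlas M B" and F: "smooth_map M B X A F"
    and sig: "signature_on ?T ?h = (1, 1)"
    using assms(2) x
    by (auto simp: lorentzian_surface_in_def smooth_manifold_def immersion_def)
  have Fx: "F x \<in> topspace X"
    using F x by (auto simp: smooth_map_def continuous_map_def)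
  have b: "scalar_product_on ?E ?b"
    using K Fx by (simp add: pseudo_kaehler_manifold_def pseudo_riemannian_metric_def)
  have j: "?j v \<in> ?E" "?j (?j v) = - v" if "v \<in> ?E" for v
    using K Fx that by (auto simp: pseudo_kaehler_manifold_def almost_complex_structure_def)
  have iso: "?b (?j u) (?j v) = ?b u v" if "u \<in> ?E" "v \<in> ?E" for u v
    using K Fx that by (auto simp: pseudo_kaehler_manifold_def)
  note E = subspace_tangent_space[OF A, of "F x"]
  note T = subspace_tangent_space[OF B, of x]
  note D = linear_differential[OF B F x]
  note DE = differential_in_tangent_space[OF B A F x]
  obtain c where c: "c \<in> B" "x \<in> fst c"
    using smooth_atlas_covers[OF B x] .
  note inj = tangent_eval_inj[OF B c]
  have bound: "dim W \<le> 2" if "subspace W" "W \<subseteq> ?T" for W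
  proof -
    have "inj_on (\<lambda>v. v c) W"
      using inj that(2) by (rule inj_on_subset)
    from dim_le_DIM_of_injective_linear[OF linear_tangent_eval this that(1)] show ?thesis
      by simp
  qed
  obtain v where v: "v \<in> ?T" "?h v v < 0"
    using index_on_nonzeroE[OF T bound, of ?h] sig by (auto simp: signature_on_def)
  obtain u where u: "u \<in> ?T" "?h u u > 0"
    using index_on_nonzeroE[OF T bound, of "\<lambda>u v. - ?h u v"] sig by (auto simp: signature_on_def)
  have neg: "?b (?D v) (?D v) < 0" and pos: "?b (?D u) (?D u) > 0"
    using u v by (auto simp: induced_metric_def)
  have "?j (?D v) \<in> ?D ` ?T"
    using inv v(1) unfolding tangent_plane_def by blast
  then obtain w where w: "w \<in> ?T" "?D w = ?j (?D v)"
    by auto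
  obtain r s t where nz: "(r, s, t) \<noteq> (0, 0, 0)"
    and dep: "r *\<^sub>R u c + s *\<^sub>R v c + t *\<^sub>R w c = 0"
    using three_vectors_in_plane_dependent .
  have "r *\<^sub>R u + s *\<^sub>R v + t *\<^sub>R w = 0"
  proof (rule inj_onD[OF inj])
    show "(r *\<^sub>R u + s *\<^sub>R v + t *\<^sub>R w) c = 0 c"
      using dep by (simp add: scaleR_fun_def)
    show "r *\<^sub>R u + s *\<^sub>R v + t *\<^sub>R w \<in> ?T" "0 \<in> ?T"
      using T u(1) v(1) w(1) by (auto intro: subspace_add subspace_scale subspace_0)
  qed
  then have "?D (r *\<^sub>R u + s *\<^sub>R v + t *\<^sub>R w) = 0"
    using linear_0[OF D] by simp
  then have "r *\<^sub>R ?D u + (s *\<^sub>R ?D v + t *\<^sub>R ?j (?D v)) = 0"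
    using w(2) by (simp add: linear_add[OF D] linear_scale[OF D] add.assoc)
  then have eq: "s *\<^sub>R ?D v + t *\<^sub>R ?j (?D v) = (- r) *\<^sub>R ?D u"
    by (simp add: add_eq_0_iff)
  \<comment> \<open>Both sides of the dependence have the same square norm, but \<open>neg\<close> makes it nonpositive
    and \<open>pos\<close> makes it nonnegative.\<close>
  have "(s\<^sup>2 + t\<^sup>2) * ?b (?D v) (?D v) = ?b ((- r) *\<^sub>R ?D u) ((- r) *\<^sub>R ?D u)"
    unfolding eq[symmetric]
  proof (rule complex_line_norm[OF E b, symmetric])
    show "?D v \<in> ?E" by (rule DE)
    then show "?j (?D v) \<in> ?E" "?j (?j (?D v)) = - ?D v" by (rule j)+
  qed (rule iso)
  also have "\<dots> = r\<^sup>2 * ?b (?D u) (?D u)"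
  proof -
    have u': "?D u \<in> ?E" "(- r) *\<^sub>R ?D u \<in> ?E"
      using DE subspace_scale[OF E DE] by blast+
    show ?thesis
      unfolding scalar_product_on_scaleR(1)[OF E b u'(2,1)] scalar_product_on_scaleR(2)[OF E b u'(1,1)]
      by (simp add: power2_eq_square)
  qed
  finally have norms: "(s\<^sup>2 + t\<^sup>2) * ?b (?D v) (?D v) = r\<^sup>2 * ?b (?D u) (?D u)" .
  moreover have "(s\<^sup>2 + t\<^sup>2) * ?b (?D v) (?D v) \<le> 0" "r\<^sup>2 * ?b (?D u) (?D u) \<ge> 0"
    using neg pos by (auto simp: mult_nonneg_nonpos)
  ultimately have "(s\<^sup>2 + t\<^sup>2) * ?b (?D v) (?D v) = 0" "r\<^sup>2 * ?b (?D u) (?D u) = 0"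
    by linarith+
  then have "s\<^sup>2 + t\<^sup>2 = 0" "r = 0"
    using neg pos by auto
  then show False
    using nz by (simp add: sum_power2_eq_zero_iff)
qed

end
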